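(* Let $\Omega\subseteq\mathbb{R}^d$ be measurable, let $p(\cdot)\in\mathcal{P}$ with $p_+<\infty$ and let $0<q\le\infty$. If there exist $t_0>0$ and a measurable set $A_{t_0}\subseteq\Omega$ with $\mu(A_{t_0})=t_0$ such that $p(x)=p_-$ for all $x\in A_{t_0}$, then $$\mathcal{E}_{\mathsf G}^{L_{p(\cdot),q}}(t)=\sup\left\{\|\chi_{A}\|_{L_{p(\cdot),q}}^{-1}: A\subseteq\Omega\text{ measurable},\ \mu(A)=t\right\},\qquad 0<t<\min\{1,t_0\}.$$
   Context: $\mu$ is Lebesgue measure on $\Omega$; $\chi_A$ is the characteristic function of $A$. For a measurable $p(\cdot):\Omega\to(0,\infty)$ put $p_-=\operatorname{ess\,inf}_{x\in\Omega}p(x)$, $p_+=\operatorname{ess\,sup}_{x\in\Omega}p(x)$. $\mathcal{P}$ is the set of such functions with $p_->0$ (exponent functions). Variable Lebesgue quasi-norm: $\|f\|_{p(\cdot)}=\inf\{\lambda>0:\int_\Omega(|f(x)|/\lambda)^{p(x)}\,dx\le1\}$. Variable Lorentz space $L_{p(\cdot),q}=L_{p(\cdot),q}(\Omega)$: the measurable $f:\Omega\to\mathbb{R}$ with finite quasi-norm $$\|f\|_{L_{p(\cdot),q}}=\left(\int_0^\infty u^q\,\|\chi_{\{|f|>u\}}\|_{p(\cdot)}^q\,\frac{du}{u}\right)^{1/q}\ (0<q<\infty),\qquad \|f\|_{L_{p(\cdot),\infty}}=\sup_{u>0}u\,\|\chi_{\{|f|>u\}}\|_{p(\cdot)}.$$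 Rearrangement: $f^*(t)=\inf\{s>0:\mu(\{|f|>s\})\le t\}$, $t\ge0$ (with $\inf\emptyset=\infty$). Growth envelope function of a quasi-normed function space $X$ on $\Omega$: $\mathcal{E}_{\mathsf G}^X(t)=\sup\{f^*(t):\|f\|_X\le1\}$, $t>0$ (computed here with exactly the quasi-norm above). *)

theory Defs
  imports "HOL-Analysis.Analysis" "HOL-Probability.Essential_Supremum"
begin

text \<open>
  The function spaces are defined over a measure space \<open>M\<close>; for a domain
  \<open>\<Omega> \<subseteq> \<real>\<^sup>d\<close> one takes \<open>M = lebesgue_on \<Omega>\<close>. Functions on \<open>\<Omega>\<close> are total functions of which
  only the restriction to \<open>space M\<close> matters. Quasi-norms, rearrangements and growth envelopes take
  values in \<open>[0, \<infinity>]\<close>.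
\<close>

text \<open>Only used for exponents \<open>a > 0\<close>, where \<open>\<infinity>\<close> to the power \<open>a\<close> is \<open>\<infinity>\<close>
  and \<open>0\<close> to the power \<open>a\<close> is \<open>0\<close>.\<close>

definition ennreal_powr :: "ennreal \<Rightarrow> real \<Rightarrow> ennreal" where
  "ennreal_powr x a = (if x = \<infinity> then \<infinity> else ennreal (enn2real x powr a))"

text \<open>The dual of \<^const>\<open>esssup\<close>.\<close>

definition essinf ::
  "'a measure \<Rightarrow> ('a \<Rightarrow> 'b::{second_countable_topology, dense_linorder, linorder_topology, complete_linorder}) \<Rightarrow> 'b"
  where "essinf M f = (if f \<in> borel_measurable M then Liminf (ae_filter M) f else bot)"

definition p_minus :: "'a measure \<Rightarrow> ('a \<Rightarrow> real) \<Rightarrow> ereal" where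
  "p_minus M p = essinf M (\<lambda>x. ereal (p x))"

definition p_plus :: "'a measure \<Rightarrow> ('a \<Rightarrow> real) \<Rightarrow> ereal" where
  "p_plus M p = esssup M (\<lambda>x. ereal (p x))"

definition exponent_functions :: "'a measure \<Rightarrow> ('a \<Rightarrow> real) set" where
  "exponent_functions M =
     {p \<in> borel_measurable M. (\<forall>x\<in>space M. 0 < p x) \<and> 0 < p_minus M p}"

definition var_lebesgue_norm :: "'a measure \<Rightarrow> ('a \<Rightarrow> real) \<Rightarrow> ('a \<Rightarrow> real) \<Rightarrow> ennreal" where
  "var_lebesgue_norm M p f =
     Inf {ennreal l | l. 0 < l \<and> (\<integral>\<^sup>+x. ennreal ((\<bar>f x\<bar> / l) powr p x) \<partial>M) \<le> 1}"

definition var_lorentz_norm ::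
  "'a measure \<Rightarrow> ('a \<Rightarrow> real) \<Rightarrow> ennreal \<Rightarrow> ('a \<Rightarrow> real) \<Rightarrow> ennreal" where
  "var_lorentz_norm M p q f =
     (let \<phi> = (\<lambda>u. var_lebesgue_norm M p (indicator {x \<in> space M. \<bar>f x\<bar> > u})) in
      if q = \<infinity> then (SUP u\<in>{0<..}. ennreal u * \<phi> u)
      else ennreal_powr
        (\<integral>\<^sup>+u\<in>{0<..}. (ennreal (u powr enn2real q) * ennreal_powr (\<phi> u) (enn2real q) / ennreal u) \<partial>lborel)
        (1 / enn2real q))"

definition var_lorentz_space ::
  "'a measure \<Rightarrow> ('a \<Rightarrow> real) \<Rightarrow> ennreal \<Rightarrow> ('a \<Rightarrow> real) set" where
  "var_lorentz_space M p q = {f \<in> borel_measurable M. var_lorentz_norm M p q f < \<infinity>}"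

definition rearrangement :: "'a measure \<Rightarrow> ('a \<Rightarrow> real) \<Rightarrow> real \<Rightarrow> ennreal" where
  "rearrangement M f t =
     Inf {ennreal s | s. 0 < s \<and> emeasure M {x \<in> space M. \<bar>f x\<bar> > s} \<le> ennreal t}"

text \<open>Here \<open>X\<close> is the carrier of the function space and \<open>N\<close> its quasi-norm.\<close>

definition growth_envelope ::
  "'a measure \<Rightarrow> ('a \<Rightarrow> real) set \<Rightarrow> (('a \<Rightarrow> real) \<Rightarrow> ennreal) \<Rightarrow> real \<Rightarrow> ennreal" where
  "growth_envelope M X N t = (SUP f\<in>{f \<in> X. N f \<le> 1}. rearrangement M f t)"

end

theory Submission
  imports Defs
begin

text \<open>
  Let \<open>\<kappa> = q powr (- 1 / q)\<close>, or \<open>\<kappa> = 1\<close> if \<open>q = \<infinity>\<close>, and \<open>a = p\<^sub>-\<close>. The Lorentz quasi-norm of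
  \<open>f\<close> dominates \<open>s \<kappa> \<parallel>\<chi>\<parallel>\<close>, where \<open>\<chi>\<close> is the characteristic function of \<open>{\<bar>f\<bar> > s}\<close>, with
  equality for multiples \<open>s \<chi>\<close> of characteristic functions. Since \<open>p \<ge> a\<close> almost everywhere, the
  characteristic function of a set of measure at least \<open>t \<le> 1\<close> has norm at least
  \<open>t powr (1 / a)\<close>, and subsets of \<open>A\<^sub>0\<close> of measure \<open>t\<close> attain this. So both sides of the claim
  equal \<open>1 / (\<kappa> * t powr (1 / a))\<close>. For the envelope one has to use sets of measure \<open>t' > t\<close> and
  let \<open>t'\<close> decrease to \<open>t\<close>, because the rearrangement at \<open>t\<close> of a multiple of the
  characteristic function of a set of measure \<open>t\<close> is \<open>0\<close>.
\<close>

section \<open>Essential infimum and powers of extended nonnegative reals\<close>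

text \<open>Negation turns \<open>essinf\<close> into \<open>esssup\<close>, for which the almost
  everywhere bound is \<open>esssup_AE\<close>.\<close>

lemma essinf_AE:
  fixes f :: "'a \<Rightarrow> ereal"
  shows "AE x in M. essinf M f \<le> f x"
proof (cases "f \<in> borel_measurable M")
  case True
  have "essinf M f = - esssup M (\<lambda>x. - f x)"
    using True by (simp add: essinf_def esssup_def ereal_Limsup_uminus)
  with esssup_AE[of "\<lambda>x. - f x" M] show ?thesis
    by (auto simp: ereal_uminus_le_reorder)
qed (simp add: essinf_def)

lemma ennreal_inverse_antimono: "x \<le> y \<Longrightarrow> inverse y \<le> inverse x" for x y :: ennreal
  by (simp add: less_eq_ennreal.rep_eq inverse_ennreal.rep_eq ereal_inverse_antimono)

lemma ennreal_powr_mono: "x \<le> y \<Longrightarrow> 0 \<le> a \<Longrightarrow> ennreal_powr x a \<le> ennreal_powr y a"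
  by (auto simp: ennreal_powr_def top_unique enn2real_mono less_top intro!: ennreal_leI powr_mono2)

lemma ennreal_powr_cmult:
  assumes "0 < c"
  shows "ennreal_powr (ennreal c * x) a = ennreal (c powr a) * ennreal_powr x a"
proof (cases x)
  case (real y)
  then have "ennreal c * x = ennreal (c * y)"
    using assms by (simp add: ennreal_mult)
  then have "ennreal_powr (ennreal c * x) a = ennreal ((c * y) powr a)"
    using real assms by (simp add: ennreal_powr_def)
  with real assms show ?thesis
    by (simp add: ennreal_powr_def powr_mult ennreal_mult)
next
  case top
  with assms show ?thesis
    by (simp add: ennreal_powr_def ennreal_mult_top)
qed

lemma ennreal_powr_powr: "0 < a \<Longrightarrow> ennreal_powr (ennreal_powr x a) (1 / a) = x"
  by (cases x) (auto simp: ennreal_powr_def powr_powr)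

text \<open>The integrand has the shape found in \<open>var_lorentz_norm\<close>, with the level-set
  factor frozen to a constant \<open>k\<close> that may be infinite; what remains is the integral of
  \<open>u powr (r - 1)\<close>.\<close>

lemma nn_integral_powr_from_0:
  fixes r c :: real
  assumes "0 < r" "0 \<le> c"
  shows "(\<integral>\<^sup>+u\<in>{0<..<c}. (ennreal (u powr r) * k / ennreal u) \<partial>lborel) = ennreal (c powr r / r) * k"
proof -
  have "(\<integral>\<^sup>+u\<in>{0<..<c}. (ennreal (u powr r) * k / ennreal u) \<partial>lborel) =
      (\<integral>\<^sup>+u. ennreal (u powr (r - 1) * indicator {0..c} u) * k \<partial>lborel)"
  proof (rule nn_integral_cong_AE)
    \<comment> \<open>The end points form a null set, so the open interval may be replaced by the
      closed one of \<open>has_integral_powr_from_0\<close>.\<close>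
    have "AE u in lborel. u \<noteq> (0::real) \<and> u \<noteq> c"
      by (auto intro: AE_conjI AE_lborel_singleton)
    then show "AE u in lborel. ennreal (u powr r) * k / ennreal u * indicator {0<..<c} u =
        ennreal (u powr (r - 1) * indicator {0..c} u) * k"
    proof eventually_elim
      case (elim u)
      have "ennreal (u powr r) * k / ennreal u = ennreal (u powr (r - 1)) * k" if "0 < u"
      proof -
        have "ennreal (u powr r) * k / ennreal u = (ennreal (u powr r) / ennreal u) * k"
          by (simp add: divide_ennreal_def ac_simps)
        with that show ?thesis by (simp add: divide_ennreal powr_diff)
      qed
      with elim show ?case by (auto simp: indicator_def)
    qed
  qed
  also have "\<dots> = (\<integral>\<^sup>+u. ennreal (u powr (r - 1) * indicator {0..c} u) \<partial>lborel) * k"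
    by (intro nn_integral_multc) auto
  also have "(\<integral>\<^sup>+u. ennreal (u powr (r - 1) * indicator {0..c} u) \<partial>lborel) = ennreal (c powr r / r)"
  proof (rule nn_integral_has_integral_lborel)
    have "((\<lambda>u. if u \<in> {0..c} then u powr (r - 1) else 0) has_integral c powr r / r) UNIV"
      using has_integral_powr_from_0[of "r - 1" c] assms by (simp only: has_integral_restrict_UNIV) simp
    also have "(\<lambda>u. if u \<in> {0..c} then u powr (r - 1) else 0) = (\<lambda>u. u powr (r - 1) * indicator {0..c} u)"
      by (auto simp: indicator_def)
    finally show "((\<lambda>u. u powr (r - 1) * indicator {0..c} u) has_integral c powr r / r) UNIV" .
  qed auto
  finally show ?thesis .
qed

section \<open>Lorentz quasi-norms of characteristic functions\<close>

text \<open>The constant \<kappa>: for finite \<open>q\<close> the \<open>1 / q\<close> power of the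
  integral of \<open>u powr (q - 1)\<close> over \<open>{0<..<1}\<close>, for infinite
  \<open>q\<close> the supremum of \<open>u < 1\<close>.\<close>

definition lorentz_factor :: "ennreal \<Rightarrow> real" where
  "lorentz_factor q = (if q = \<infinity> then 1 else enn2real q powr (- 1 / enn2real q))"

lemma lorentz_factor_pos: "0 < q \<Longrightarrow> 0 < lorentz_factor q"
  using enn2real_positive_iff[of q] by (auto simp: lorentz_factor_def less_top)

lemma lorentz_factor_integral:
  assumes "0 < q" "q \<noteq> \<infinity>" "0 < c"
  shows "ennreal_powr (\<integral>\<^sup>+u\<in>{0<..<c}. (ennreal (u powr enn2real q) * ennreal_powr v (enn2real q) / ennreal u) \<partial>lborel)
      (1 / enn2real q) = ennreal (c * lorentz_factor q) * v"
proof -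
  define r where "r = enn2real q"
  have "0 < r" using assms by (auto simp: r_def enn2real_positive_iff less_top)
  moreover have "(c powr r / r) powr (1 / r) = c * r powr (- 1 / r)"
    using \<open>0 < r\<close> assms by (simp add: powr_divide powr_powr powr_minus_divide)
  ultimately show ?thesis
    using assms unfolding r_def[symmetric]
    by (simp add: nn_integral_powr_from_0 ennreal_powr_cmult ennreal_powr_powr lorentz_factor_def r_def)
qed

lemma var_lebesgue_norm_indicator_mono:
  assumes "\<forall>x\<in>space M. 0 < p x" "A \<subseteq> B"
  shows "var_lebesgue_norm M p (indicator A) \<le> var_lebesgue_norm M p (indicator B)"
  unfolding var_lebesgue_norm_def
proof (rule Inf_superset_mono, safe)
  fix l :: real
  assume l: "0 < l" and le: "(\<integral>\<^sup>+x. ennreal ((\<bar>indicator B x\<bar> / l) powr p x) \<partial>M) \<le> 1"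
  have "(\<integral>\<^sup>+x. ennreal ((\<bar>indicator A x\<bar> / l) powr p x) \<partial>M) \<le>
      (\<integral>\<^sup>+x. ennreal ((\<bar>indicator B x\<bar> / l) powr p x) \<partial>M)"
    using assms l by (intro nn_integral_mono) (auto simp: indicator_def)
  with l le show "\<exists>l'. ennreal l = ennreal l' \<and> 0 < l' \<and>
      (\<integral>\<^sup>+x. ennreal ((\<bar>indicator A x\<bar> / l') powr p x) \<partial>M) \<le> 1"
    by (intro exI[of _ l]) auto
qed

lemma var_lebesgue_norm_empty: "var_lebesgue_norm M p (indicator {}) = 0"
proof -
  have "var_lebesgue_norm M p (indicator {}) \<le> ennreal e" if "0 < e" for e
    unfolding var_lebesgue_norm_def using that by (intro Inf_lower) auto
  then show ?thesis
    using ennreal_le_epsilon[of 0 "var_lebesgue_norm M p (indicator {})"] by simp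
qed

text \<open>Level sets shrink as the height grows, so below \<open>s\<close> their norms are at
  least the one at \<open>s\<close>. Cutting the integral down to \<open>{0<..<s}\<close> leaves an
  explicit integral; for infinite \<open>q\<close> a single term of the supremum suffices.\<close>

lemma var_lorentz_norm_ge_level_set:
  assumes "\<forall>x\<in>space M. 0 < p x" "0 < q" "0 < s"
  shows "ennreal (s * lorentz_factor q) * var_lebesgue_norm M p (indicator {x \<in> space M. \<bar>f x\<bar> > s})
    \<le> var_lorentz_norm M p q f"
proof (cases "q = \<infinity>")
  case True
  with assms show ?thesis
    by (auto simp: var_lorentz_norm_def lorentz_factor_def Let_def intro: SUP_upper2)
next
  case False
  define \<phi> where "\<phi> u = var_lebesgue_norm M p (indicator {x \<in> space M. \<bar>f x\<bar> > u})" for u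
  have "\<phi> s \<le> \<phi> u" if "u < s" for u
    unfolding \<phi>_def using assms that by (intro var_lebesgue_norm_indicator_mono) auto
  then have "(\<integral>\<^sup>+u\<in>{0<..<s}. (ennreal (u powr enn2real q) * ennreal_powr (\<phi> s) (enn2real q) / ennreal u) \<partial>lborel)
    \<le> (\<integral>\<^sup>+u\<in>{0<..}. (ennreal (u powr enn2real q) * ennreal_powr (\<phi> u) (enn2real q) / ennreal u) \<partial>lborel)"
    by (intro nn_integral_mono)
      (auto simp: indicator_def intro!: divide_right_mono_ennreal mult_left_mono ennreal_powr_mono)
  from ennreal_powr_mono[OF this, of "1 / enn2real q"] show ?thesis
    using False assms by (simp add: lorentz_factor_integral var_lorentz_norm_def \<phi>_def)
qed

text \<open>Level sets at heights in \<open>{0<..<c}\<close> all equal \<open>A\<close> and those at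
  heights from \<open>c\<close> on are empty, so the level-set norm is constant and then 0.\<close>

lemma var_lorentz_norm_cmult_indicator:
  assumes "0 < q" "0 < c" "A \<subseteq> space M"
  shows "var_lorentz_norm M p q (\<lambda>x. c * indicator A x) =
    ennreal (c * lorentz_factor q) * var_lebesgue_norm M p (indicator A)"
proof -
  define v where "v = var_lebesgue_norm M p (indicator A)"
  have "{x \<in> space M. u < \<bar>c * indicator A x\<bar>} = (if u < c then A else {})" if "0 < u" for u
    using that assms by (auto simp: indicator_def)
  then have level: "var_lebesgue_norm M p (indicator {x \<in> space M. u < \<bar>c * indicator A x\<bar>}) =
      (if u < c then v else 0)" if "0 < u" for u
    using that by (simp add: v_def var_lebesgue_norm_empty)
  show ?thesis
  proof (cases "q = \<infinity>")
    case True
    have "(SUP u\<in>{0<..}. ennreal u * (if u < c then v else 0)) = ennreal c * v"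
    proof (rule antisym)
      have "(SUP u\<in>{0<..<c}. ennreal u) = ennreal c"
      proof (rule antisym)
        show "ennreal c \<le> (SUP u\<in>{0<..<c}. ennreal u)"
        proof (rule dense_le)
          \<comment> \<open>The supremum over the open interval is not attained, so density supplies
            a height \<open>w\<close> between \<open>y\<close> and \<open>c\<close>.\<close>
          fix y assume "y < ennreal c"
          then obtain z where "y = ennreal z" "0 \<le> z" "z < c"
            by (cases y) (auto simp: ennreal_less_iff)
          with \<open>0 < c\<close> dense[of z c] obtain w where "z < w" "w < c" "0 < w" by auto
          with \<open>y = ennreal z\<close> show "y \<le> (SUP u\<in>{0<..<c}. ennreal u)"
            by (intro SUP_upper2[of w]) (auto intro: ennreal_leI)
        qed
      qed (auto intro!: SUP_least ennreal_leI)
      then have "ennreal c * v = (SUP u\<in>{0<..<c}. ennreal u * v)"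
        by (metis SUP_mult_right_ennreal)
      also have "\<dots> \<le> (SUP u\<in>{0<..}. ennreal u * (if u < c then v else 0))"
        by (intro SUP_least) (auto intro!: SUP_upper2)
      finally show "ennreal c * v \<le> (SUP u\<in>{0<..}. ennreal u * (if u < c then v else 0))" .
    qed (auto intro!: SUP_least mult_right_mono ennreal_leI)
    moreover have "var_lorentz_norm M p q (\<lambda>x. c * indicator A x) =
        (SUP u\<in>{0<..}. ennreal u * (if u < c then v else 0))"
      using True unfolding var_lorentz_norm_def Let_def
      by (auto simp: level intro!: SUP_cong)
    ultimately show ?thesis
      using True by (simp add: lorentz_factor_def v_def)
  next
    case False
    then have r: "0 < enn2real q"
      using assms by (simp add: enn2real_positive_iff less_top)
    have "(\<integral>\<^sup>+u\<in>{0<..}. (ennreal (u powr enn2real q) *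
        ennreal_powr (var_lebesgue_norm M p (indicator {x \<in> space M. u < \<bar>c * indicator A x\<bar>})) (enn2real q)
          / ennreal u) \<partial>lborel) =
      (\<integral>\<^sup>+u\<in>{0<..<c}. (ennreal (u powr enn2real q) * ennreal_powr v (enn2real q) / ennreal u) \<partial>lborel)"
    proof (rule nn_integral_cong)
      fix u :: real
      let ?v = "var_lebesgue_norm M p (indicator {x \<in> space M. u < \<bar>c * indicator A x\<bar>})"
      show "ennreal (u powr enn2real q) * ennreal_powr ?v (enn2real q) / ennreal u * indicator {0<..} u =
          ennreal (u powr enn2real q) * ennreal_powr v (enn2real q) / ennreal u * indicator {0<..<c} u"
        using r level[of u] by (cases "0 < u"; cases "u < c") (simp_all add: ennreal_powr_def)
    qed
    with False assms show ?thesis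
      by (simp add: lorentz_factor_integral var_lorentz_norm_def v_def)
  qed
qed

section \<open>Variable Lebesgue quasi-norms of characteristic functions\<close>

text \<open>If \<open>l < 1\<close>, then \<open>1 / l > 1\<close> and \<open>a \<le> p x\<close>
  bound the modular below by \<open>(1 / l) powr a * t\<close>, so an admissible \<open>l\<close>
  satisfies \<open>t \<le> l powr a\<close>. If \<open>l \<ge> 1\<close>, the bound follows from
  \<open>t \<le> 1\<close>.\<close>

lemma var_lebesgue_norm_indicator_ge:
  assumes "0 < a" "AE x in M. a \<le> p x" "B \<in> sets M" "0 < t" "t \<le> 1" "ennreal t \<le> emeasure M B"
  shows "ennreal (t powr (1 / a)) \<le> var_lebesgue_norm M p (indicator B)"
  unfolding var_lebesgue_norm_def
proof (intro Inf_greatest, safe)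
  fix l :: real
  assume l: "0 < l" and le: "(\<integral>\<^sup>+x. ennreal ((\<bar>indicator B x\<bar> / l) powr p x) \<partial>M) \<le> 1"
  show "ennreal (t powr (1 / a)) \<le> ennreal l"
  proof (cases "l < 1")
    case True
    have "ennreal ((1 / l) powr a * t) \<le> ennreal ((1 / l) powr a) * emeasure M B"
      using assms by (simp add: ennreal_mult' mult_left_mono)
    also have "\<dots> = (\<integral>\<^sup>+x. ennreal ((1 / l) powr a) * indicator B x \<partial>M)"
      using assms by (simp add: nn_integral_cmult_indicator)
    also have "\<dots> \<le> (\<integral>\<^sup>+x. ennreal ((\<bar>indicator B x\<bar> / l) powr p x) \<partial>M)"
      using assms(2)
      by (intro nn_integral_mono_AE, elim AE_mp)
        (use l True in \<open>auto simp: indicator_def intro!: ennreal_leI powr_mono\<close>)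
    finally have "(1 / l) powr a * t \<le> 1"
      using le by (metis ennreal_le_1 order_trans)
    then have "t \<le> l powr a" using l by (simp add: powr_divide field_simps)
    then have "t powr (1 / a) \<le> (l powr a) powr (1 / a)"
      using assms by (intro powr_mono2) auto
    with l assms show ?thesis by (simp add: powr_powr)
  next
    case False
    have "t powr (1 / a) \<le> 1"
      using assms by (intro powr_le1) auto
    with False show ?thesis by (intro ennreal_leI) auto
  qed
qed

text \<open>With the exponent constantly \<open>a\<close> on \<open>B\<close>, the choice
  \<open>l = t powr (1 / a)\<close> makes the modular exactly 1, so the general lower bound is
  attained.\<close>

lemma var_lebesgue_norm_indicator_eq:
  assumes "0 < a" "AE x in M. a \<le> p x" "B \<in> sets M" "0 < t" "t \<le> 1" "emeasure M B = ennreal t"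
    and "\<forall>x\<in>B. p x = a"
  shows "var_lebesgue_norm M p (indicator B) = ennreal (t powr (1 / a))"
proof (rule antisym)
  have "(\<integral>\<^sup>+x. ennreal ((\<bar>indicator B x\<bar> / t powr (1 / a)) powr p x) \<partial>M) =
      (\<integral>\<^sup>+x. ennreal (1 / t) * indicator B x \<partial>M)"
    using assms by (intro nn_integral_cong) (auto simp: indicator_def powr_divide powr_powr)
  also have "\<dots> = 1"
    using assms by (simp add: nn_integral_cmult_indicator flip: ennreal_mult')
  finally show "var_lebesgue_norm M p (indicator B) \<le> ennreal (t powr (1 / a))"
    unfolding var_lebesgue_norm_def using assms by (intro Inf_lower) auto
qed (use assms in \<open>auto intro: var_lebesgue_norm_indicator_ge\<close>)

section \<open>Bounds for the growth envelope\<close>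

text \<open>For \<open>s > 1 / k\<close>, a level set at height \<open>s\<close> of measure above
  \<open>t\<close> would force the quasi-norm of \<open>f\<close> to be at least
  \<open>s * k > 1\<close>. Hence every such \<open>s\<close> is admissible in the infimum defining
  the rearrangement.\<close>

lemma growth_envelope_le:
  assumes "\<forall>x\<in>space M. 0 < p x" "0 < a" "AE x in M. a \<le> p x" "0 < q" "0 < t" "t \<le> 1"
  shows "growth_envelope M (var_lorentz_space M p q) (var_lorentz_norm M p q) t
    \<le> ennreal (1 / (lorentz_factor q * t powr (1 / a)))"
  unfolding growth_envelope_def
proof (rule SUP_least)
  define k where "k = lorentz_factor q * t powr (1 / a)"
  have k: "0 < k" using assms by (simp add: k_def lorentz_factor_pos)
  fix f assume "f \<in> {f \<in> var_lorentz_space M p q. var_lorentz_norm M p q f \<le> 1}"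
  then have f: "f \<in> borel_measurable M" "var_lorentz_norm M p q f \<le> 1"
    by (auto simp: var_lorentz_space_def)
  have "rearrangement M f t \<le> ennreal s" if s: "1 / k < s" for s
  proof -
    from k s have "0 < s" by (meson divide_pos_pos less_trans zero_less_one)
    let ?B = "{x \<in> space M. \<bar>f x\<bar> > s}"
    have "emeasure M ?B \<le> ennreal t"
    proof (rule ccontr)
      assume "\<not> ?thesis"
      then have "ennreal (t powr (1 / a)) \<le> var_lebesgue_norm M p (indicator ?B)"
        using assms f by (intro var_lebesgue_norm_indicator_ge) auto
      then have "ennreal (s * lorentz_factor q) * ennreal (t powr (1 / a)) \<le>
          ennreal (s * lorentz_factor q) * var_lebesgue_norm M p (indicator ?B)"
        by (rule mult_left_mono) simp
      also have "\<dots> \<le> var_lorentz_norm M p q f"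
        using assms \<open>0 < s\<close> by (intro var_lorentz_norm_ge_level_set)
      also note f(2)
      finally have "ennreal (s * k) \<le> 1"
        using \<open>0 < s\<close> assms by (simp add: k_def ac_simps less_imp_le[OF lorentz_factor_pos] flip: ennreal_mult')
      with s k show False by (simp add: field_simps)
    qed
    with \<open>0 < s\<close> show ?thesis
      unfolding rearrangement_def by (intro Inf_lower) auto
  qed
  \<comment> \<open>Only heights strictly above \<open>1 / k\<close> are covered, hence the slack
    \<open>e\<close>.\<close>
  then have "rearrangement M f t \<le> ennreal (1 / k + e)" if "0 < e" for e
    using that by simp
  then have "rearrangement M f t \<le> ennreal (1 / k) + ennreal e" if "0 < e" for e
    using that k by simp
  then have "rearrangement M f t \<le> ennreal (1 / k)"
    by (rule ennreal_le_epsilon)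
  then show "rearrangement M f t \<le> ennreal (1 / (lorentz_factor q * t powr (1 / a)))"
    by (simp only: k_def)
qed

text \<open>The witness is \<open>c * indicator A\<close>, with \<open>c\<close> chosen to make its
  quasi-norm 1. Its level sets below \<open>c\<close> have measure \<open>t' > t\<close>, so its
  rearrangement at \<open>t\<close> is at least \<open>c\<close>.\<close>

lemma growth_envelope_ge:
  assumes "0 < a" "AE x in M. a \<le> p x" "0 < q" "0 < t" "t < t'" "t' \<le> 1"
    and "A \<in> sets M" "emeasure M A = ennreal t'" "\<forall>x\<in>A. p x = a"
  shows "ennreal (1 / (lorentz_factor q * t' powr (1 / a)))
    \<le> growth_envelope M (var_lorentz_space M p q) (var_lorentz_norm M p q) t"
proof -
  define c where "c = 1 / (lorentz_factor q * t' powr (1 / a))"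
  have c: "0 < c" using assms by (simp add: c_def lorentz_factor_pos)
  let ?f = "\<lambda>x. c * indicator A x"
  have A: "A \<subseteq> space M" using assms sets.sets_into_space by blast
  have "var_lebesgue_norm M p (indicator A) = ennreal (t' powr (1 / a))"
    using assms by (intro var_lebesgue_norm_indicator_eq) auto
  then have "var_lorentz_norm M p q ?f = ennreal (c * lorentz_factor q * t' powr (1 / a))"
    using assms c A lorentz_factor_pos[of q]
    by (simp add: var_lorentz_norm_cmult_indicator flip: ennreal_mult')
  also have "\<dots> = 1"
    using assms lorentz_factor_pos[of q] by (simp add: c_def)
  finally have "?f \<in> {f \<in> var_lorentz_space M p q. var_lorentz_norm M p q f \<le> 1}"
    using assms by (auto simp: var_lorentz_space_def)
  moreover have "ennreal c \<le> rearrangement M ?f t"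
    unfolding rearrangement_def
  proof (intro Inf_greatest, safe)
    fix s assume s: "0 < s" "emeasure M {x \<in> space M. s < \<bar>c * indicator A x\<bar>} \<le> ennreal t"
    show "ennreal c \<le> ennreal s"
    proof (rule ccontr)
      assume "\<not> ?thesis"
      then have "{x \<in> space M. s < \<bar>c * indicator A x\<bar>} = A"
        using s c A by (auto simp: indicator_def not_le ennreal_less_iff)
      with s assms show False by simp
    qed
  qed
  ultimately show ?thesis
    unfolding growth_envelope_def c_def[symmetric] by (intro SUP_upper2)
qed

text \<open>Nothing here is specific to Euclidean space: the domain enters through
  \<open>sub\<close>, which supplies sets of every measure below \<open>t0\<close> on which the
  exponent is \<open>a\<close>.\<close>

lemma growth_envelope_var_lorentz:
  assumes p: "\<forall>x\<in>space M. 0 < p x" "0 < a" "AE x in M. a \<le> p x" and q: "0 < q"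
    and t: "0 < t" "t < min 1 t0"
    and sub: "\<And>s. 0 < s \<Longrightarrow> s < t0 \<Longrightarrow> \<exists>A\<in>sets M. emeasure M A = ennreal s \<and> (\<forall>x\<in>A. p x = a)"
  shows "growth_envelope M (var_lorentz_space M p q) (var_lorentz_norm M p q) t =
    Sup {inverse (var_lorentz_norm M p q (indicator A)) | A. A \<in> sets M \<and> emeasure M A = ennreal t}"
    (is "?E = ?S")
proof -
  let ?k = "lorentz_factor q"
  let ?R = "\<lambda>s. ennreal (1 / (?k * s powr (1 / a)))"
  have k: "0 < ?k" using q by (rule lorentz_factor_pos)
  have norm: "var_lorentz_norm M p q (indicator A) = ennreal ?k * var_lebesgue_norm M p (indicator A)"
    if "A \<in> sets M" for A
    using var_lorentz_norm_cmult_indicator[of q 1 A M p] q sets.sets_into_space[OF that] by simp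
  have R: "?R t = inverse (ennreal ?k * ennreal (t powr (1 / a)))"
    using k t by (simp add: inverse_ennreal inverse_eq_divide flip: ennreal_mult')
  have "?E = ?R t"
  proof (rule antisym)
    \<comment> \<open>As \<open>?R\<close> is continuous at \<open>t > 0\<close>, the lower bounds
      from sets of measure \<open>s > t\<close> pass to the limit; near \<open>t\<close>, such
      \<open>s\<close> stay below \<open>min 1 t0\<close>.\<close>
    have "((\<lambda>s. ?R s) \<longlongrightarrow> ?R t) (at_right t)"
      using k t by (intro tendsto_intros) (auto)
    moreover have "eventually (\<lambda>s. ?R s \<le> ?E) (at_right t)"
      using eventually_at_right_less[of t] eventually_at_right_real[of t "min 1 t0", OF t(2)]
    proof eventually_elim
      case (elim s)
      with sub[of s] t obtain A where "A \<in> sets M" "emeasure M A = ennreal s" "\<forall>x\<in>A. p x = a"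
        by auto
      with elim p q t show ?case by (intro growth_envelope_ge) auto
    qed
    ultimately show "?R t \<le> ?E"
      by (rule tendsto_upperbound) simp
  qed (use p q t in \<open>auto intro: growth_envelope_le\<close>)
  also have "?R t = ?S"
  proof (rule antisym)
    \<comment> \<open>On the right-hand side a set of measure exactly \<open>t\<close> already
      attains the value.\<close>
    from sub[of t] t obtain A where A: "A \<in> sets M" "emeasure M A = ennreal t" "\<forall>x\<in>A. p x = a"
      by auto
    with p t have "var_lebesgue_norm M p (indicator A) = ennreal (t powr (1 / a))"
      by (intro var_lebesgue_norm_indicator_eq) auto
    with A norm[of A] R have "?R t = inverse (var_lorentz_norm M p q (indicator A))" by simp
    with A show "?R t \<le> ?S" by (auto intro: Sup_upper)
  next
    show "?S \<le> ?R t"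
    proof (intro Sup_least, safe)
      fix A assume A: "A \<in> sets M" "emeasure M A = ennreal t"
      with p t have "ennreal (t powr (1 / a)) \<le> var_lebesgue_norm M p (indicator A)"
        by (intro var_lebesgue_norm_indicator_ge) auto
      then show "inverse (var_lorentz_norm M p q (indicator A)) \<le> ?R t"
        unfolding norm[OF A(1)] R by (intro ennreal_inverse_antimono mult_left_mono) auto
    qed
  qed
  finally show ?thesis .
qed

section \<open>Subsets of prescribed Lebesgue measure\<close>

text \<open>The intermediate value theorem applies to the measure of
  \<open>A \<inter> cball 0 r\<close>, which is continuous in \<open>r\<close>, vanishes at 0 and
  tends to the measure of \<open>A\<close>.\<close>

lemma lebesgue_subset_of_measure:
  fixes A :: "'a::euclidean_space set"
  assumes "A \<in> lmeasurable" "0 \<le> s" "s < measure lebesgue A"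
  shows "\<exists>B\<in>sets lebesgue. B \<subseteq> A \<and> emeasure lebesgue B = ennreal s"
proof -
  define g where "g r = measure lebesgue (A \<inter> cball 0 r)" for r
  have fm: "A \<inter> cball 0 r \<in> lmeasurable" for r
    using assms by (intro fmeasurable_Int_fmeasurable) auto
  let ?b = "\<lambda>r. measure lebesgue (cball (0::'a) r)"
  \<comment> \<open>An increment of \<open>g\<close> measures the part of \<open>A\<close> in a
    spherical shell, so the volume of the shell bounds it and \<open>g\<close> inherits continuity
    from the ball volume.\<close>
  have g_diff: "\<bar>g y - g x\<bar> \<le> \<bar>?b y - ?b x\<bar>" for x y
  proof (induction x y rule: linorder_wlog)
    case (le x y)
    have sub: "cball (0::'a) x \<subseteq> cball 0 y" using le by auto
    have "g y - g x = measure lebesgue (A \<inter> cball 0 y - A \<inter> cball 0 x)"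
      unfolding g_def using sub fm by (intro measurable_measure_Diff[symmetric]) auto
    also have "\<dots> \<le> measure lebesgue (cball (0::'a) y - cball 0 x)"
      using fm by (intro measure_mono_fmeasurable) (auto intro: fmeasurable.Diff)
    also have "\<dots> = ?b y - ?b x"
      using sub by (subst measurable_measure_Diff) auto
    finally have "g y - g x \<le> ?b y - ?b x" .
    moreover have "g x \<le> g y"
      unfolding g_def using sub fm by (intro measure_mono_fmeasurable) auto
    ultimately show ?case by linarith
  qed (simp add: abs_minus_commute)
  have cont: "continuous_on {0..n} g" for n
  proof -
    have "continuous_on {0..n} ?b"
      by (rule continuous_on_eq[of _ "\<lambda>r. unit_ball_vol (real DIM('a)) * r ^ DIM('a)"])
        (auto simp: content_cball intro!: continuous_intros)
    then show ?thesis
      unfolding continuous_on_iff dist_real_def using g_diff by (meson le_less_trans)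
  qed
  have UN: "(\<Union>n. A \<inter> cball 0 (real n)) = A"
    using real_arch_simple by auto
  have "(\<lambda>n. measure lebesgue (A \<inter> cball 0 (real n))) \<longlonglongrightarrow> measure lebesgue (\<Union>n. A \<inter> cball 0 (real n))"
  proof (rule Lim_measure_incseq)
    show "emeasure lebesgue (\<Union>n. A \<inter> cball 0 (real n)) \<noteq> \<infinity>"
      unfolding UN using fmeasurableD2[OF assms(1)] by simp
  qed (use fm in \<open>auto simp: incseq_def fmeasurable_def\<close>)
  also note UN
  \<comment> \<open>The strict inequality \<open>s < measure lebesgue A\<close> yields an integer
    radius at which \<open>g\<close> exceeds \<open>s\<close>.\<close>
  finally have "eventually (\<lambda>n. s < g (real n)) sequentially"
    unfolding g_def using assms(3) by (rule order_tendstoD(1))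
  then obtain n where "s < g (real n)" by (auto simp: eventually_sequentially)
  moreover have "g 0 = 0"
    unfolding g_def using negligible_imp_measure0[of "A \<inter> {0}"] by (auto simp: negligible_Int)
  ultimately obtain r where "g r = s"
    using IVT'[of g 0 s "real n"] cont assms by auto
  then show ?thesis
    using fm[of r] by (intro bexI[of _ "A \<inter> cball 0 r"]) (auto simp: g_def emeasure_eq_measure2)
qed

section \<open>The growth envelope over a Euclidean domain\<close>

theorem corollary6p3:
  fixes \<Omega> :: "(real ^ 'd) set"
    and p :: "real ^ 'd \<Rightarrow> real"
    and q :: ennreal
    and t0 t :: real
    and A0 :: "(real ^ 'd) set"
  assumes "\<Omega> \<in> sets lebesgue"
    and "p \<in> exponent_functions (lebesgue_on \<Omega>)"
    and "p_plus (lebesgue_on \<Omega>) p < \<infinity>"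
    and "0 < q"
    and "0 < t0"
    and "A0 \<in> sets lebesgue" and "A0 \<subseteq> \<Omega>"
    and "emeasure lebesgue A0 = ennreal t0"
    and "\<forall>x\<in>A0. ereal (p x) = p_minus (lebesgue_on \<Omega>) p"
    and "0 < t" and "t < min 1 t0"
  shows "growth_envelope (lebesgue_on \<Omega>)
           (var_lorentz_space (lebesgue_on \<Omega>) p q) (var_lorentz_norm (lebesgue_on \<Omega>) p q) t =
         Sup {inverse (var_lorentz_norm (lebesgue_on \<Omega>) p q (indicator A)) | A.
                A \<in> sets lebesgue \<and> A \<subseteq> \<Omega> \<and> emeasure lebesgue A = ennreal t}"
proof -
  let ?M = "lebesgue_on \<Omega>"
  have sets: "A \<in> sets ?M \<longleftrightarrow> A \<in> sets lebesgue \<and> A \<subseteq> \<Omega>" for A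
    using assms(1) by (auto simp: sets_restrict_space_iff)
  have emeasure: "emeasure ?M A = emeasure lebesgue A" if "A \<subseteq> \<Omega>" for A
    using assms(1) that by (simp add: emeasure_restrict_space)
  \<comment> \<open>Positive measure makes \<open>A0\<close> nonempty, so the extended real
    \<open>p_minus\<close> is the real number \<open>p x0\<close>.\<close>
  from assms(5,8) obtain x0 where "x0 \<in> A0" by fastforce
  define a where "a = p x0"
  have pm: "p_minus ?M p = ereal a" using assms(9) \<open>x0 \<in> A0\<close> by (simp add: a_def)
  have p: "\<forall>x\<in>space ?M. 0 < p x" "0 < a"
    using assms(2) pm by (auto simp: exponent_functions_def)
  have AE: "AE x in ?M. a \<le> p x"
    using essinf_AE[of ?M "\<lambda>x. ereal (p x)"] pm by (simp add: p_minus_def)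
  have A0: "A0 \<in> lmeasurable" "measure lebesgue A0 = t0"
    using assms(5,6,8) by (auto simp: fmeasurable_def measure_def)
  have "\<exists>A\<in>sets ?M. emeasure ?M A = ennreal s \<and> (\<forall>x\<in>A. p x = a)" if s: "0 < s" "s < t0" for s
  proof -
    \<comment> \<open>A subset of \<open>A0\<close> inherits the constant exponent
      \<open>a\<close>.\<close>
    obtain B where "B \<in> sets lebesgue" "B \<subseteq> A0" "emeasure lebesgue B = ennreal s"
      using lebesgue_subset_of_measure[of A0 s] A0 s by auto
    moreover from this have "B \<subseteq> \<Omega>" using assms(7) by blast
    ultimately show ?thesis
      using assms(9) pm by (intro bexI[of _ B]) (auto simp: sets emeasure)
  qed
  from growth_envelope_var_lorentz[OF p AE assms(4,10,11) this] show ?thesis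
    by (auto simp: sets emeasure intro!: arg_cong[where f = Sup])
qed

end
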